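(* Let $a,m$ be integers with $1<a<m$ and $\gcd(a,m)=1$, and let $$\Lambda(a,m)=\{(x,y)\in\mathbb Z\times\mathbb Z \mid ax+y\equiv 0 \pmod m\}\subset\mathbb R^2.$$ Then for every s-state $\widehat{\mathcal X}_k$ ($0\le k\le N$) of Qin's algorithm on input $(a,m)$, the two rows of $\widehat{\mathcal X}_k$ form a basis of the lattice $\Lambda(a,m)$. In particular, the volume of the lattice $\Lambda(a,m)$ is $m$.
   Context: Qin's algorithm on input $(a,m)$ (integers, $1<a<m$, $\gcd(a,m)=1$) produces a finite sequence of states $\mathcal X_k=\begin{pmatrix}x_{11}^{(k)}&x_{12}^{(k)}\\ x_{21}^{(k)}&x_{22}^{(k)}\end{pmatrix}$ as follows. The initial state is $\mathcal X_0=\begin{pmatrix}1&a\\0&m\end{pmatrix}$. For $k\ge 1$, as long as $x_{12}^{(k-1)}\neq 1$, step $k$ produces $\mathcal X_k$ from $\mathcal X_{k-1}$: (i) if $x_{22}^{(k-1)}>x_{12}^{(k-1)}$, set $q_k=\left\lfloor \frac{x_{22}^{(k-1)}-1}{x_{12}^{(k-1)}}\right\rfloor$, $x_{21}^{(k)}=x_{21}^{(k-1)}+q_kx_{11}^{(k-1)}$, $x_{22}^{(k)}=x_{22}^{(k-1)}-q_kx_{12}^{(k-1)}$, and leave the first row unchanged; (ii) if $x_{12}^{(k-1)}>x_{22}^{(k-1)}$, set $q_k=\left\lfloor \frac{x_{12}^{(k-1)}-1}{x_{22}^{(k-1)}}\right\rfloor$, $x_{11}^{(k)}=x_{11}^{(k-1)}+q_kx_{21}^{(k-1)}$,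 $x_{12}^{(k)}=x_{12}^{(k-1)}-q_kx_{22}^{(k-1)}$, and leave the second row unchanged. The algorithm stops at the first index $N$ with $x_{12}^{(N)}=1$; $N$ is the number of steps. The s-state at step $k$ is $\widehat{\mathcal X}_k=\begin{pmatrix}x_{11}^{(k)}&-x_{12}^{(k)}\\ x_{21}^{(k)}&x_{22}^{(k)}\end{pmatrix}$. A basis means a $\mathbb Z$-basis; the volume of a rank-2 lattice in $\mathbb R^2$ is the absolute value of the determinant of the matrix whose rows are a basis. *)

theory Defs
  imports "HOL-Analysis.Analysis" "HOL-Number_Theory.Cong"
begin

section \<open>Qin's algorithm\<close>

definition qin_init :: "int \<Rightarrow> int \<Rightarrow> int^2^2" where
  "qin_init a m = vector [vector [1, a], vector [0, m]]"

text \<open>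
  On integers, \<open>div\<close> rounds towards minus infinity, so \<open>(u - 1) div v\<close> is the floor of
  \<open>(u - 1) / v\<close>. The last branch (equal entries) is only there to make the function total:
  it is not reached before the algorithm stops (see \<open>qin_step_entries\<close> below).
\<close>
definition qin_step :: "int^2^2 \<Rightarrow> int^2^2" where
  "qin_step X =
    (if X$2$2 > X$1$2 then
       let q = (X$2$2 - 1) div X$1$2
       in vector [X$1, vector [X$2$1 + q * X$1$1, X$2$2 - q * X$1$2]]
     else if X$1$2 > X$2$2 then
       let q = (X$1$2 - 1) div X$2$2
       in vector [vector [X$1$1 + q * X$2$1, X$1$2 - q * X$2$2], X$2]
     else X)"

text \<open>
  The sequence is continued beyond the stopping index; only the states with index at most
  \<open>qin_steps a m\<close> belong to the run of the algorithm.
\<close>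
definition qin_state :: "int \<Rightarrow> int \<Rightarrow> nat \<Rightarrow> int^2^2" where
  "qin_state a m k = (qin_step ^^ k) (qin_init a m)"

definition qin_steps :: "int \<Rightarrow> int \<Rightarrow> nat" where
  "qin_steps a m = (LEAST N. qin_state a m N $1$2 = 1)"

definition s_state :: "int^2^2 \<Rightarrow> int^2^2" where
  "s_state X = vector [vector [X$1$1, - (X$1$2)], vector [X$2$1, X$2$2]]"

text \<open>
  The next two lemmas show that the algorithm terminates, so that the \<open>LEAST\<close> in
  \<open>qin_steps_def\<close> is attained.
\<close>
lemma qin_step_entries:
  assumes "X$1$2 > 0" "X$2$2 > 0" "coprime (X$1$2) (X$2$2)" "X$1$2 \<noteq> 1"
  shows "X$1$2 \<noteq> X$2$2"
    and "qin_step X $1$2 > 0" "qin_step X $2$2 > 0"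
    and "coprime (qin_step X $1$2) (qin_step X $2$2)"
    and "qin_step X $1$2 + qin_step X $2$2 < X$1$2 + X$2$2"
proof -
  have key: "v - ((v - 1) div u) * u > 0" "v - ((v - 1) div u) * u < v"
    "coprime u (v - ((v - 1) div u) * u)"
    if "0 < u" "u < v" "coprime u v" for u v :: int
  proof -
    have "(v - 1) div u * u \<le> v - 1"
      using div_mult_mod_eq[of "v - 1" u] pos_mod_sign[OF that(1), of "v - 1"] by linarith
    then show "v - ((v - 1) div u) * u > 0" by linarith
    have "(v - 1) div u > 0" using that by (simp add: pos_imp_zdiv_pos_iff)
    then show "v - ((v - 1) div u) * u < v" using that by simp
    show "coprime u (v - ((v - 1) div u) * u)"
      using that(3) by (metis coprime_iff_gcd_eq_1 gcd_diff2 gcd_add_mult diff_add_cancel add.commute mult.commute)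
  qed
  show ne: "X$1$2 \<noteq> X$2$2" using assms by auto
  show "qin_step X $1$2 > 0" "qin_step X $2$2 > 0"
    "coprime (qin_step X $1$2) (qin_step X $2$2)"
    "qin_step X $1$2 + qin_step X $2$2 < X$1$2 + X$2$2"
    using ne assms key[of "X$1$2" "X$2$2"] key[of "X$2$2" "X$1$2"]
    by (auto simp: qin_step_def Let_def coprime_commute)
qed

lemma qin_terminates:
  assumes "1 < a" "a < m" "gcd a m = 1"
  shows "\<exists>N. qin_state a m N $1$2 = 1"
proof (rule ccontr)
  assume no: "\<nexists>N. qin_state a m N $1$2 = 1"
  let ?X = "qin_state a m"
  have inv: "?X k $1$2 > 0 \<and> ?X k $2$2 > 0 \<and> coprime (?X k $1$2) (?X k $2$2)
      \<and> ?X k $1$2 + ?X k $2$2 \<le> a + m - int k" for k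
  proof (induction k)
    case 0
    then show ?case using assms by (simp add: qin_state_def qin_init_def coprime_iff_gcd_eq_1)
  next
    case (Suc k)
    have "?X (Suc k) = qin_step (?X k)" by (simp add: qin_state_def)
    then show ?case using qin_step_entries[of "?X k"] Suc no by force
  qed
  show False using inv[of "nat (a + m)"] assms by auto
qed

section \<open>Lattices in the plane\<close>

definition int_scale :: "int \<Rightarrow> 'v::real_vector \<Rightarrow> 'v" where
  "int_scale c v = of_int c *\<^sub>R v"

global_interpretation zmodule: module int_scale
  by unfold_locales (simp_all add: int_scale_def algebra_simps)

text \<open>
  \<open>rows A\<close> is a set, so injectivity is needed for the rows to be a basis as a family.
\<close>
definition rows_Z_basis :: "real^2^2 \<Rightarrow> (real^2) set \<Rightarrow> bool" where
  "rows_Z_basis A L \<longleftrightarrow>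
     inj (\<lambda>i. row i A) \<and> zmodule.independent (rows A) \<and> zmodule.span (rows A) = L"

text \<open>
  Two bases differ by an integer matrix of determinant plus or minus one, so the value
  described here does not depend on the basis.
\<close>
definition lattice_volume :: "(real^2) set \<Rightarrow> real" where
  "lattice_volume L = (THE v. \<exists>A. rows_Z_basis A L \<and> v = \<bar>det A\<bar>)"

definition qin_lattice :: "int \<Rightarrow> int \<Rightarrow> (real^2) set" where
  "qin_lattice a m = {vector [of_int x, of_int y] | x y. [a * x + y = 0] (mod m)}"

definition real_matrix :: "int^2^2 \<Rightarrow> real^2^2" where
  "real_matrix X = (\<chi> i j. of_int (X$i$j))"

end

theory Submission
  imports Defs
begin

text \<open>
  In terms of s-states, a step of the algorithm adds \<open>q\<close> times one row to the other: the sign in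
  the s-state turns the subtraction in the second column into an addition. So every s-state arises
  from the initial one, with rows \<open>(1, -a)\<close> and \<open>(0, m)\<close>, by integral row operations. Two properties
  survive such operations: both rows lie in \<open>\<Lambda>(a,m)\<close>, and the determinant is \<open>m\<close>
  (\<open>qin_state_invariant\<close>).

  These two properties already make the rows a basis (\<open>rows_Z_basis_qin_latticeI\<close>). By Cramer's
  rule, a vector of \<open>\<Lambda>(a,m)\<close> has coordinates with respect to the rows that are \<open>2 \<times> 2\<close> determinants
  divided by \<open>m\<close>; each numerator is the determinant of two vectors of \<open>\<Lambda>(a,m)\<close>, and all such
  determinants are divisible by \<open>m\<close> (\<open>dvd_det_of_congruent\<close>).

  For the volume, the determinants of two bases of one lattice divide each other, hence agree up to
  sign (\<open>rows_Z_basis_abs_det_unique\<close>), and the initial s-state has determinant \<open>m\<close>.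
\<close>

section \<open>Bases of lattices in the plane\<close>

lemma rows_2: "rows A = {row 1 A, row 2 A}" for A :: "'a^'n^2"
  unfolding rows_def by (auto intro: exI[of _ 1] exI[of _ 2]) (metis exhaust_2)

lemma zmodule_span_rows_2:
  fixes A :: "real^'n^2"
  shows "v \<in> zmodule.span (rows A) \<longleftrightarrow>
    (\<exists>c d. v = of_int c *\<^sub>R row 1 A + of_int d *\<^sub>R row 2 A)"
  unfolding rows_2 zmodule.span_insert zmodule.span_empty int_scale_def
  by (auto simp: algebra_simps)

lemma rows_Z_independent_if_det_nonzero:
  fixes A :: "real^2^2"
  assumes "det A \<noteq> 0"
  shows "inj (\<lambda>i. row i A)" "zmodule.independent (rows A)"
proof -
  have fin: "finite (rows A)" by (simp add: rows_2)
  have ne: "row 1 A \<noteq> row 2 A"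
    using assms det_identical_rows[of 1 2 A] by force
  show "inj (\<lambda>i. row i A)"
    using ne unfolding inj_def forall_2 by auto
  have indep: "vec.independent (rows A)"
    using assms det_dependent_rows[of A] by blast
  show "zmodule.independent (rows A)"
  proof
    assume "zmodule.dependent (rows A)"
    then obtain u where u: "\<exists>v\<in>rows A. u v \<noteq> 0" "(\<Sum>v\<in>rows A. int_scale (u v) v) = 0"
      unfolding zmodule.dependent_finite[OF fin] by blast
    then have "vec.dependent (rows A)"
      unfolding vec.dependent_finite[OF fin] int_scale_def
      by (intro exI[of _ "\<lambda>v. of_int (u v)"]) (auto simp: scalar_mult_eq_scaleR)
    with indep show False by blast
  qed
qed

lemma det_of_rows_in_zmodule_span:
  fixes A B :: "real^2^2"
  assumes "rows B \<subseteq> zmodule.span (rows A)"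
  obtains p :: int where "det B = of_int p * det A"
proof -
  have "row 1 B \<in> zmodule.span (rows A)" "row 2 B \<in> zmodule.span (rows A)"
    using assms by (auto simp: rows_2)
  then obtain c d c' d' where
    r: "row 1 B = of_int c *\<^sub>R row 1 A + of_int d *\<^sub>R row 2 A"
    "row 2 B = of_int c' *\<^sub>R row 1 A + of_int d' *\<^sub>R row 2 A"
    unfolding zmodule_span_rows_2 by blast
  have entries: "B$1$j = of_int c * A$1$j + of_int d * A$2$j"
    "B$2$j = of_int c' * A$1$j + of_int d' * A$2$j" for j
    using arg_cong[OF r(1), of "\<lambda>v. v$j"] arg_cong[OF r(2), of "\<lambda>v. v$j"]
    by (simp_all add: row_def)
  have "det B = of_int (c * d' - d * c') * det A"
    by (simp add: det_2 entries algebra_simps)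
  then show thesis by (rule that)
qed

lemma rows_Z_basis_abs_det_unique:
  assumes "rows_Z_basis A L" "rows_Z_basis B L"
  shows "\<bar>det A\<bar> = \<bar>det B\<bar>"
proof -
  have span: "zmodule.span (rows A) = L" "zmodule.span (rows B) = L"
    using assms by (simp_all add: rows_Z_basis_def)
  have "rows B \<subseteq> zmodule.span (rows A)" "rows A \<subseteq> zmodule.span (rows B)"
    using zmodule.span_superset[of "rows A"] zmodule.span_superset[of "rows B"] span by auto
  then obtain p q :: int where pq: "det B = of_int p * det A" "det A = of_int q * det B"
    by (metis det_of_rows_in_zmodule_span)
  show ?thesis
  proof (cases "det A = 0")
    case True
    then show ?thesis using pq(1) by simp
  next
    case False
    have "of_int (p * q) * det A = 1 * det A"
      using pq by (simp add: ac_simps)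
    with False have "p * q = 1"
      by (metis mult_right_cancel of_int_1 of_int_eq_iff)
    then have "\<bar>p\<bar> = 1"
      by (metis abs_zmult_eq_1 abs_one)
    then have "\<bar>of_int p :: real\<bar> = 1" by linarith
    then show ?thesis using pq(1) by (simp add: abs_mult)
  qed
qed

lemma lattice_volume_eq:
  assumes "rows_Z_basis A L"
  shows "lattice_volume L = \<bar>det A\<bar>"
  unfolding lattice_volume_def
  using assms by (intro the_equality) (auto dest: rows_Z_basis_abs_det_unique)

section \<open>The lattice \<open>\<Lambda>(a,m)\<close>\<close>

text \<open>
  Modulo \<open>m\<close>, the vectors concerned are multiples of \<open>(1, -a)\<close>, hence pairwise proportional.
\<close>
lemma dvd_det_of_congruent:
  fixes a m x y u v :: int
  assumes "m dvd a * x + y" "m dvd a * u + v"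
  shows "m dvd x * v - y * u"
proof -
  have "x * v - y * u = x * (a * u + v) - u * (a * x + y)" by (simp add: algebra_simps)
  then show ?thesis using assms by simp
qed

lemma real_matrix_s_state:
  "row 1 (real_matrix (s_state X)) = vector [of_int (X$1$1), - of_int (X$1$2)]"
  "row 2 (real_matrix (s_state X)) = vector [of_int (X$2$1), of_int (X$2$2)]"
  "det (real_matrix (s_state X)) = of_int (X$1$1 * X$2$2 + X$1$2 * X$2$1)"
  by (simp_all add: vec_eq_iff forall_2 row_def real_matrix_def s_state_def det_2)

lemma rows_Z_basis_qin_latticeI:
  fixes X :: "int^2^2"
  assumes m: "m \<noteq> 0"
    and det: "X$1$1 * X$2$2 + X$1$2 * X$2$1 = m"
    and row1: "m dvd a * X$1$1 - X$1$2"
    and row2: "m dvd a * X$2$1 + X$2$2"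
  shows "rows_Z_basis (real_matrix (s_state X)) (qin_lattice a m)"
proof -
  let ?A = "real_matrix (s_state X)"
  have span_iff: "v \<in> zmodule.span (rows ?A) \<longleftrightarrow>
      (\<exists>c d. v = vector [of_int (c * X$1$1 + d * X$2$1), of_int (d * X$2$2 - c * X$1$2)])" for v
    by (simp add: zmodule_span_rows_2 real_matrix_s_state vec_eq_iff forall_2 algebra_simps)
  have "zmodule.span (rows ?A) = qin_lattice a m"
  proof (intro set_eqI iffI)
    fix v assume "v \<in> zmodule.span (rows ?A)"
    then obtain c d where v:
      "v = vector [of_int (c * X$1$1 + d * X$2$1), of_int (d * X$2$2 - c * X$1$2)]"
      unfolding span_iff by blast
    have "a * (c * X$1$1 + d * X$2$1) + (d * X$2$2 - c * X$1$2) =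
        c * (a * X$1$1 - X$1$2) + d * (a * X$2$1 + X$2$2)"
      by (simp add: algebra_simps)
    also have "m dvd \<dots>" using row1 row2 by simp
    finally show "v \<in> qin_lattice a m"
      unfolding qin_lattice_def v cong_0_iff by blast
  next
    fix v assume "v \<in> qin_lattice a m"
    then obtain x y where v: "v = vector [of_int x, of_int y]" and xy: "m dvd a * x + y"
      unfolding qin_lattice_def cong_0_iff by blast
    \<comment> \<open>The quotients by \<open>m\<close> are the coordinates given by Cramer's rule.\<close>
    have "m dvd x * X$2$2 - y * X$2$1"
      using dvd_det_of_congruent[OF xy row2] .
    then obtain c where c: "x * X$2$2 - y * X$2$1 = m * c" by (rule dvdE)
    have "m dvd X$1$1 * y - (- X$1$2) * x"
      using dvd_det_of_congruent[of m a "X$1$1" "- X$1$2" x y] row1 xy by simp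
    then obtain d where d: "X$1$1 * y - (- X$1$2) * x = m * d" by (rule dvdE)
    have "m * (c * X$1$1 + d * X$2$1) = (m * c) * X$1$1 + (m * d) * X$2$1"
      by (simp add: algebra_simps)
    also have "\<dots> = (X$1$1 * X$2$2 + X$1$2 * X$2$1) * x"
      unfolding c[symmetric] d[symmetric] by (simp add: algebra_simps)
    finally have x: "x = c * X$1$1 + d * X$2$1" using m det by simp
    have "m * (d * X$2$2 - c * X$1$2) = (m * d) * X$2$2 - (m * c) * X$1$2"
      by (simp add: algebra_simps)
    also have "\<dots> = (X$1$1 * X$2$2 + X$1$2 * X$2$1) * y"
      unfolding c[symmetric] d[symmetric] by (simp add: algebra_simps)
    finally have y: "y = d * X$2$2 - c * X$1$2" using m det by simp
    show "v \<in> zmodule.span (rows ?A)"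
      unfolding span_iff v x y by blast
  qed
  moreover have "det ?A \<noteq> 0"
    using m det by (simp only: real_matrix_s_state of_int_eq_0_iff not_False_eq_True)
  ultimately show ?thesis
    unfolding rows_Z_basis_def using rows_Z_independent_if_det_nonzero[of ?A] by blast
qed

section \<open>The states of the algorithm\<close>

text \<open>
  On the s-state, a step adds an integral multiple of one row to the other. This preserves the
  determinant and membership of the rows in a lattice, whatever the multiple.
\<close>
lemma qin_step_invariant:
  fixes X :: "int^2^2"
  assumes "X$1$1 * X$2$2 + X$1$2 * X$2$1 = m"
    and "m dvd a * X$1$1 - X$1$2" "m dvd a * X$2$1 + X$2$2"
  shows "qin_step X$1$1 * qin_step X$2$2 + qin_step X$1$2 * qin_step X$2$1 = m"
    and "m dvd a * qin_step X$1$1 - qin_step X$1$2"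
    and "m dvd a * qin_step X$2$1 + qin_step X$2$2"
proof -
  have row_op: "a * (X$2$1 + q * X$1$1) + (X$2$2 - q * X$1$2) =
      (a * X$2$1 + X$2$2) + q * (a * X$1$1 - X$1$2)"
    "a * (X$1$1 + q * X$2$1) - (X$1$2 - q * X$2$2) =
      (a * X$1$1 - X$1$2) + q * (a * X$2$1 + X$2$2)" for q
    by (simp_all add: algebra_simps)
  have dvd: "m dvd a * (X$2$1 + q * X$1$1) + (X$2$2 - q * X$1$2)"
    "m dvd a * (X$1$1 + q * X$2$1) - (X$1$2 - q * X$2$2)" for q
    unfolding row_op using assms(2,3) by simp_all
  show "qin_step X$1$1 * qin_step X$2$2 + qin_step X$1$2 * qin_step X$2$1 = m"
    using assms(1) by (auto simp: qin_step_def Let_def algebra_simps)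
  show "m dvd a * qin_step X$1$1 - qin_step X$1$2"
    "m dvd a * qin_step X$2$1 + qin_step X$2$2"
    using assms(2,3) dvd by (auto simp: qin_step_def Let_def)
qed

lemma qin_state_invariant:
  fixes a m :: int and k :: nat
  defines "X \<equiv> qin_state a m k"
  shows "X$1$1 * X$2$2 + X$1$2 * X$2$1 = m \<and>
    m dvd a * X$1$1 - X$1$2 \<and> m dvd a * X$2$1 + X$2$2"
  unfolding X_def
proof (induction k)
  case 0
  show ?case by (simp add: qin_state_def qin_init_def)
next
  case (Suc k)
  have "qin_state a m (Suc k) = qin_step (qin_state a m k)" by (simp add: qin_state_def)
  then show ?case using qin_step_invariant[of "qin_state a m k" m a] Suc by simp
qed

theorem theorem4p1:
  fixes a m :: int
  assumes "1 < a" and "a < m" and "gcd a m = 1"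
  shows "(\<forall>k \<le> qin_steps a m. rows_Z_basis (real_matrix (s_state (qin_state a m k))) (qin_lattice a m))
    \<and> lattice_volume (qin_lattice a m) = of_int m"
proof -
  have m: "m > 0" using assms by simp
  have basis: "rows_Z_basis (real_matrix (s_state (qin_state a m k))) (qin_lattice a m)" for k
    using m qin_state_invariant[where a = a and m = m and k = k]
    by (intro rows_Z_basis_qin_latticeI) auto
  have "det (real_matrix (s_state (qin_state a m 0))) = of_int m"
    using qin_state_invariant[where a = a and m = m and k = 0]
    by (simp only: real_matrix_s_state)
  then have "lattice_volume (qin_lattice a m) = of_int m"
    using lattice_volume_eq[OF basis[of 0]] m by simp
  with basis show ?thesis by blast
qed

end
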